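(* Let $A_i$, $i\ge -1$, be nonnegative $m\times m$ matrices such that $\sum_{i=-1}^\infty A_i$ is stochastic. Let $q\ge -1$ be an integer and let $A_\ell(z)=\sum_{i=0}^\infty A_{\ell,i}z^i$, $\ell=-1,0,\ldots,q$, be matrix power series with $A_{\ell,i}\ge 0$ for all $\ell,i$ and $$\sum_{\ell=-1}^q A_\ell(z)z^{\ell+1}=\sum_{i=-1}^\infty A_i z^{i+1}.$$ Set $X_0=0$ and, for $k\ge 0$, define $X_{k+1}$ as the minimal nonnegative solution $X$ of the matrix equation $$X=\sum_{\ell=-1}^q A_\ell(X_k)X^{\ell+1}.$$ Then the sequence $\{X_k\}_k$ is well defined, and $0\le X_k\le X_{k+1}$ and $X_{k+1}\mathbf 1\le \mathbf 1$ for $k=0,1,\ldots$. Moreover, the sequence $\{X_k\}_k$ converges monotonically to the minimal nonnegative solution $G$ of the matrix equation $X=\sum_{i=-1}^\infty A_iX^{i+1}$.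
   Context: Matrices are real, inequalities between matrices and vectors are entrywise, and $\mathbf 1$ is the vector of all ones. For a power series $A_\ell(z)=\sum_{i\ge0}A_{\ell,i}z^i$ with $m\times m$ coefficients and an $m\times m$ matrix $X$, $A_\ell(X)=\sum_{i\ge 0}A_{\ell,i}X^i$ (coefficients on the left), with $X^0=I$. The minimal nonnegative solution of a matrix equation is the nonnegative solution $G$ such that $G\le Y$ for every nonnegative solution $Y$; it is a known fact that for nonnegative $A_i$ with $(\sum_{i\ge-1} A_i)\mathbf 1\le\mathbf 1$ the equation $X=\sum_{i=-1}^\infty A_iX^{i+1}$ has a unique minimal nonnegative solution $G$, and $G\mathbf 1\le\mathbf 1$. *)

theory Defs
  imports "HOL-Analysis.Analysis" "HOL-Computational_Algebra.Formal_Power_Series"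
begin

text \<open>
  Matrices are elements of \<^typ>\<open>real ^ 'm ^ 'm\<close>. The order and \<open>0\<close> of this type are the entrywise
  ones, but so are its \<open>1\<close>, \<open>*\<close> and \<open>^\<close>; hence the explicit matrix power below.
\<close>

primrec mat_pow :: "real ^ 'm ^ 'm \<Rightarrow> nat \<Rightarrow> real ^ 'm ^ 'm" where
  "mat_pow X 0 = mat 1"
| "mat_pow X (Suc n) = X ** mat_pow X n"

definition stochastic :: "real ^ 'm ^ 'm \<Rightarrow> bool" where
  "stochastic P \<longleftrightarrow> 0 \<le> P \<and> P *v vec 1 = vec 1"

definition mps_converges :: "(nat \<Rightarrow> real ^ 'm ^ 'm) \<Rightarrow> real ^ 'm ^ 'm \<Rightarrow> bool" where
  "mps_converges C X \<longleftrightarrow> summable (\<lambda>i. C i ** mat_pow X i)"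

text \<open>The value is meaningful only if \<^term>\<open>mps_converges C X\<close>.\<close>

definition mps_eval :: "(nat \<Rightarrow> real ^ 'm ^ 'm) \<Rightarrow> real ^ 'm ^ 'm \<Rightarrow> real ^ 'm ^ 'm" where
  "mps_eval C X = (\<Sum>i. C i ** mat_pow X i)"

text \<open>
  Identities between matrix power series are stated entrywise, over \<^typ>\<open>real fps\<close>: in
  \<open>(real ^ 'm ^ 'm) fps\<close> the product would be built from the entrywise one.
\<close>

definition mps_entry :: "(nat \<Rightarrow> real ^ 'm ^ 'm) \<Rightarrow> 'm \<Rightarrow> 'm \<Rightarrow> real fps" where
  "mps_entry C r c = Abs_fps (\<lambda>i. C i $ r $ c)"

text \<open>
  A family \<open>A\<^sub>i\<close>, \<open>i \<ge> -1\<close>, is a function on \<^typ>\<open>int\<close> whose values below \<open>-1\<close> are irrelevant. Listed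
  from \<open>0\<close>, it is the coefficient sequence of \<open>\<Sum>\<^sub>i A\<^sub>i z\<^bsup>i+1\<^esup>\<close>.
\<close>

definition from_minus1 :: "(int \<Rightarrow> 'b) \<Rightarrow> nat \<Rightarrow> 'b" where
  "from_minus1 A j = A (int j - 1)"

definition minimal_nonneg_solution ::
    "(real ^ 'm ^ 'm \<Rightarrow> bool) \<Rightarrow> real ^ 'm ^ 'm \<Rightarrow> bool" where
  "minimal_nonneg_solution E G \<longleftrightarrow> E G \<and> 0 \<le> G \<and> (\<forall>Y. E Y \<and> 0 \<le> Y \<longrightarrow> G \<le> Y)"

definition series_equation :: "(int \<Rightarrow> real ^ 'm ^ 'm) \<Rightarrow> real ^ 'm ^ 'm \<Rightarrow> bool" where
  "series_equation A X \<longleftrightarrow>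
     mps_converges (from_minus1 A) X \<and> X = mps_eval (from_minus1 A) X"

definition step_equation ::
    "int \<Rightarrow> (int \<Rightarrow> nat \<Rightarrow> real ^ 'm ^ 'm) \<Rightarrow> real ^ 'm ^ 'm \<Rightarrow> real ^ 'm ^ 'm \<Rightarrow> bool" where
  "step_equation q B W X \<longleftrightarrow>
     (\<forall>l\<in>{-1..q}. mps_converges (B l) W) \<and>
     X = (\<Sum>l\<in>{-1..q}. mps_eval (B l) W ** mat_pow X (nat (l + 1)))"

definition iteration ::
    "int \<Rightarrow> (int \<Rightarrow> nat \<Rightarrow> real ^ 'm ^ 'm) \<Rightarrow> (nat \<Rightarrow> real ^ 'm ^ 'm) \<Rightarrow> bool" where
  "iteration q B X \<longleftrightarrow>
     X 0 = 0 \<and> (\<forall>k. minimal_nonneg_solution (step_equation q B (X k)) (X (Suc k)))"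

end

theory Submission
  imports Defs
begin

text \<open>
  For substochastic \<open>W\<close> the coefficients \<open>B\<^sub>l(W)\<close> are nonnegative with row sums of \<open>\<Sum>\<^sub>l B\<^sub>l(W)\<close> at most
  \<open>1\<close>, so iterating \<open>X \<mapsto> F(W, X) = \<Sum>\<^sub>l B\<^sub>l(W) X\<^bsup>l+1\<^esup>\<close> from \<open>0\<close> yields a substochastic solution of
  \<open>X = F(W, X)\<close> that lies below every \<open>Y \<ge> 0\<close> with \<open>F(W, Y) \<le> Y\<close>. As \<open>F\<close> is monotone in \<open>W\<close>, the \<open>X\<^sub>k\<close>
  increase to a substochastic limit \<open>G\<close>; continuity of \<open>B\<^sub>l\<close> on substochastic matrices gives
  \<open>G = F(G, G)\<close>, which is the series equation. A solution \<open>Y \<ge> 0\<close> of the series equation with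
  \<open>X\<^sub>k \<le> Y\<close> satisfies \<open>F(X\<^sub>k, Y) \<le> Y\<close>, hence \<open>X\<^sub>k\<^sub>+\<^sub>1 \<le> Y\<close>, so \<open>G\<close> is minimal.
\<close>

section \<open>Limits and series in ordered Euclidean spaces\<close>

text \<open>The differences \<open>g n - f n\<close> lie in the closed set \<open>{0..}\<close>, so
  their limit does too.\<close>

lemma LIMSEQ_le_eucl:
  fixes f g :: "nat \<Rightarrow> 'a :: ordered_euclidean_space"
  assumes "f \<longlonglongrightarrow> a" "g \<longlonglongrightarrow> b" "\<And>n. f n \<le> g n"
  shows "a \<le> b"
proof -
  have "(\<lambda>n. g n - f n) \<longlonglongrightarrow> b - a"
    using assms by (intro tendsto_diff)
  then have "b - a \<in> {0..}"
    using assms(3) by (intro Lim_in_closed_set[OF closed_eucl_atLeast]) auto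
  then show ?thesis by simp
qed

lemma suminf_le_eucl:
  fixes f g :: "nat \<Rightarrow> 'a :: ordered_euclidean_space"
  assumes "summable f" "summable g" "\<And>n. f n \<le> g n"
  shows "suminf f \<le> suminf g"
  by (rule LIMSEQ_le_eucl[OF summable_LIMSEQ summable_LIMSEQ]) (auto intro: assms sum_mono)

lemma suminf_nonneg_eucl:
  fixes f :: "nat \<Rightarrow> 'a :: ordered_euclidean_space"
  assumes "summable f" "\<And>n. 0 \<le> f n"
  shows "0 \<le> suminf f"
  using suminf_le_eucl[OF summable_zero assms] by simp

lemma norm_le_eucl:
  fixes x y :: "'a :: ordered_euclidean_space"
  assumes "0 \<le> x" "x \<le> y"
  shows "norm x \<le> norm y"
proof (rule norm_le_componentwise)
  fix b :: 'a assume "b \<in> Basis"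
  then have "0 \<le> x \<bullet> b" "x \<bullet> b \<le> y \<bullet> b"
    using assms eucl_le[of 0 x] eucl_le[of x y] by auto
  then show "\<bar>x \<bullet> b\<bar> \<le> \<bar>y \<bullet> b\<bar>" by linarith
qed

text \<open>For nonnegative terms the sum of the coordinates, a linear functional, dominates the
  norm, so convergence is automatically absolute.\<close>

lemma summable_norm_nonneg_eucl:
  fixes f :: "nat \<Rightarrow> 'a :: ordered_euclidean_space"
  assumes "summable f" "\<And>n. 0 \<le> f n"
  shows "summable (\<lambda>n. norm (f n))"
proof (rule summable_comparison_test')
  show "summable (\<lambda>n. \<Sum>b\<in>Basis. f n \<bullet> b)"
    by (intro summable_sum bounded_linear.summable[OF bounded_linear_inner_left] assms)
  show "norm (norm (f n)) \<le> (\<Sum>b\<in>Basis. f n \<bullet> b)" for n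
  proof -
    have "norm (f n) \<le> (\<Sum>b\<in>Basis. \<bar>f n \<bullet> b\<bar>)"
      by (rule norm_le_l1)
    also have "\<dots> = (\<Sum>b\<in>Basis. f n \<bullet> b)"
      using assms(2)[of n] eucl_le[of 0 "f n"] by (intro sum.cong) auto
    finally show ?thesis by simp
  qed
qed

lemma summable_comparison_eucl:
  fixes f g :: "nat \<Rightarrow> 'a :: ordered_euclidean_space"
  assumes "summable g" "\<And>n. 0 \<le> f n" "\<And>n. f n \<le> g n"
  shows "summable f"
proof (rule summable_comparison_test')
  show "summable (\<lambda>n. norm (g n))"
    by (rule summable_norm_nonneg_eucl[OF assms(1) order_trans[OF assms(2,3)]])
  show "norm (f n) \<le> norm (g n)" for n
    using assms by (intro norm_le_eucl)
qed

text \<open>Each coordinate is a bounded increasing real sequence, so it converges; the limits are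
  assembled along \<open>Basis\<close>.\<close>

lemma incseq_convergent_eucl:
  fixes X :: "nat \<Rightarrow> 'a :: ordered_euclidean_space"
  assumes "incseq X" "\<And>n. X n \<le> B"
  obtains L where "X \<longlonglongrightarrow> L"
proof -
  have "convergent (\<lambda>n. X n \<bullet> b)" if "b \<in> Basis" for b
  proof -
    have "incseq (\<lambda>n. X n \<bullet> b)" "\<forall>n. X n \<bullet> b \<le> B \<bullet> b"
      using assms that by (auto simp: incseq_def intro: inner_Basis_mono)
    then show ?thesis
      by (meson incseq_convergent convergentI)
  qed
  then have "\<forall>b\<in>Basis. \<exists>l. (\<lambda>n. X n \<bullet> b) \<longlonglongrightarrow> l"
    by (auto simp: convergent_def)
  then obtain l where l: "\<And>b. b \<in> Basis \<Longrightarrow> (\<lambda>n. X n \<bullet> b) \<longlonglongrightarrow> l b"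
    by metis
  have "X \<longlonglongrightarrow> (\<Sum>b\<in>Basis. l b *\<^sub>R b)"
    by (rule tendsto_componentwise_iff[THEN iffD2]) (simp add: l)
  then show ?thesis by (rule that)
qed

section \<open>Nonnegative matrices\<close>

lemma matrix_mult_mono:
  fixes A A' :: "real ^ 'n ^ 'm" and B B' :: "real ^ 'k ^ 'n"
  assumes "0 \<le> A" "A \<le> A'" "0 \<le> B" "B \<le> B'"
  shows "A ** B \<le> A' ** B'"
proof -
  have "0 \<le> A'" using assms order_trans by blast
  then show ?thesis using assms
    by (auto simp: less_eq_vec_def matrix_matrix_mult_def intro!: sum_mono mult_mono)
qed

lemma matrix_mult_nonneg:
  fixes A :: "real ^ 'n ^ 'm" and B :: "real ^ 'k ^ 'n"
  assumes "0 \<le> A" "0 \<le> B"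
  shows "0 \<le> A ** B"
  using assms by (auto simp: less_eq_vec_def matrix_matrix_mult_def intro!: sum_nonneg)

lemma matrix_vector_mult_mono:
  fixes A A' :: "real ^ 'n ^ 'm"
  assumes "0 \<le> A" "A \<le> A'" "0 \<le> v" "v \<le> v'"
  shows "A *v v \<le> A' *v v'"
proof -
  have "0 \<le> A'" using assms order_trans by blast
  then show ?thesis using assms
    by (auto simp: less_eq_vec_def matrix_vector_mult_def intro!: sum_mono mult_mono)
qed

lemma bounded_bilinear_matrix_mult:
  "bounded_bilinear ((**) :: real ^ 'n ^ 'm \<Rightarrow> real ^ 'k ^ 'n \<Rightarrow> real ^ 'k ^ 'm)"
  unfolding bilinear_conv_bounded_bilinear[symmetric] bilinear_def
  by (auto intro!: linearI simp: vec_eq_iff matrix_matrix_mult_def algebra_simps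
      sum.distrib sum_distrib_left)

lemma bounded_bilinear_matrix_vector_mult:
  "bounded_bilinear ((*v) :: real ^ 'n ^ 'm \<Rightarrow> real ^ 'n \<Rightarrow> real ^ 'm)"
  unfolding bilinear_conv_bounded_bilinear[symmetric] bilinear_def
  by (auto intro!: linearI simp: vec_eq_iff matrix_vector_mult_def algebra_simps
      sum.distrib sum_distrib_left)

lemmas tendsto_matrix_mult = bounded_bilinear.tendsto[OF bounded_bilinear_matrix_mult]
lemmas continuous_on_matrix_mult = bounded_bilinear.continuous_on[OF bounded_bilinear_matrix_mult]
lemmas bounded_linear_matrix_mult_left =
  bounded_bilinear.bounded_linear_left[OF bounded_bilinear_matrix_mult]
lemmas bounded_linear_matrix_vector_mult_left =
  bounded_bilinear.bounded_linear_left[OF bounded_bilinear_matrix_vector_mult]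

lemma matrix_mult_sum_left: "(\<Sum>l\<in>L. A l) ** M = (\<Sum>l\<in>L. A l ** M)"
  for M :: "real ^ 'k ^ 'n"
  by (rule linear_sum[OF bounded_linear.linear[OF bounded_linear_matrix_mult_left]])

lemma matrix_vector_mult_sum_left: "(\<Sum>l\<in>L. A l) *v v = (\<Sum>l\<in>L. A l *v v)"
  for v :: "real ^ 'n"
  by (rule linear_sum[OF bounded_linear.linear[OF bounded_linear_matrix_vector_mult_left]])

lemma mat_1_nonneg: "0 \<le> (mat 1 :: real ^ 'm ^ 'm)"
  by (auto simp: less_eq_vec_def mat_def)

lemma mat_pow_nonneg: "0 \<le> X \<Longrightarrow> 0 \<le> mat_pow X n"
  by (induction n) (auto intro: mat_1_nonneg matrix_mult_nonneg)

lemma mat_pow_mono: "0 \<le> X \<Longrightarrow> X \<le> Y \<Longrightarrow> mat_pow X n \<le> mat_pow Y n"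
  by (induction n) (auto intro: matrix_mult_mono mat_pow_nonneg)

lemma mat_pow_add: "mat_pow X (i + j) = mat_pow X i ** mat_pow X j"
  by (induction i) (auto simp: matrix_mul_assoc)

lemma continuous_on_mat_pow: "continuous_on S (\<lambda>X. mat_pow X n)"
  by (induction n) (auto intro!: continuous_on_matrix_mult)

lemma tendsto_mat_pow: "(X \<longlongrightarrow> Y) F \<Longrightarrow> ((\<lambda>k. mat_pow (X k) n) \<longlongrightarrow> mat_pow Y n) F"
  by (induction n) (auto intro!: tendsto_matrix_mult)

text \<open>The invariant of the iteration: this set contains \<open>0\<close> and is closed under
  products and limits, and power series with nonnegative summable coefficients converge on
  it.\<close>

definition substochastic :: "real ^ 'm ^ 'm \<Rightarrow> bool" where
  "substochastic W \<longleftrightarrow> 0 \<le> W \<and> W *v vec 1 \<le> vec 1"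

lemma substochastic_0: "substochastic 0"
  by (simp add: substochastic_def less_eq_vec_def)

lemma substochastic_mat_1: "substochastic (mat 1)"
  by (simp add: substochastic_def mat_1_nonneg)

lemma substochastic_mult:
  assumes "substochastic V" "substochastic W"
  shows "substochastic (V ** W)"
proof -
  have "0 \<le> W *v vec 1"
    using assms matrix_vector_mult_mono[of 0 W "vec 1" "vec 1"]
    by (auto simp: substochastic_def less_eq_vec_def)
  then have "V *v (W *v vec 1) \<le> V *v vec 1"
    using assms by (intro matrix_vector_mult_mono) (auto simp: substochastic_def)
  then show ?thesis
    using assms by (auto simp: substochastic_def matrix_vector_mul_assoc[symmetric]
        intro: matrix_mult_nonneg)
qed

lemma substochastic_mat_pow: "substochastic W \<Longrightarrow> substochastic (mat_pow W n)"
  by (induction n) (auto intro: substochastic_mult substochastic_mat_1)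

text \<open>A nonnegative entry is at most its row sum. The bound does not depend on
  \<open>W\<close>, so it bounds the increasing iterates and yields a common majorant for power
  series.\<close>

lemma substochastic_le_1:
  fixes W :: "real ^ 'm ^ 'm"
  assumes "substochastic W"
  shows "W \<le> (\<chi> i j. 1)"
proof -
  have "W $ i $ j \<le> 1" for i j
  proof -
    have "W $ i $ j \<le> (\<Sum>k\<in>UNIV. W $ i $ k)"
      using assms by (intro member_le_sum) (auto simp: substochastic_def less_eq_vec_def)
    also have "\<dots> = (W *v vec 1) $ i"
      by (simp add: matrix_vector_mult_def)
    also have "\<dots> \<le> 1"
      using assms by (simp add: substochastic_def less_eq_vec_def)
    finally show ?thesis .
  qed
  then show ?thesis by (simp add: less_eq_vec_def)
qed

lemma substochastic_LIMSEQ: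
  assumes "X \<longlonglongrightarrow> G" "\<And>n. substochastic (X n)"
  shows "substochastic G"
  unfolding substochastic_def
proof
  show "0 \<le> G"
    by (rule LIMSEQ_le_eucl[OF tendsto_const assms(1)]) (use assms(2) in \<open>simp add: substochastic_def\<close>)
  show "G *v vec 1 \<le> vec 1"
    by (rule LIMSEQ_le_eucl[OF bounded_linear.tendsto[OF bounded_linear_matrix_vector_mult_left assms(1)]
          tendsto_const]) (use assms(2) in \<open>simp add: substochastic_def\<close>)
qed

section \<open>Matrix power series\<close>

lemma mps_term_bound:
  assumes "substochastic W" "0 \<le> C"
  shows "C ** mat_pow W i \<le> C ** (\<chi> i j. 1)" "0 \<le> C ** mat_pow W i"
proof -
  have "0 \<le> mat_pow W i" "mat_pow W i \<le> (\<chi> i j. 1)"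
    using substochastic_mat_pow[OF assms(1), of i] substochastic_le_1
    by (auto simp: substochastic_def)
  then show "C ** mat_pow W i \<le> C ** (\<chi> i j. 1)" "0 \<le> C ** mat_pow W i"
    using assms by (auto intro: matrix_mult_mono matrix_mult_nonneg)
qed

lemma mps_converges_substochastic:
  assumes "summable C" "\<And>i. 0 \<le> C i" "substochastic W"
  shows "mps_converges C W"
  unfolding mps_converges_def
  by (rule summable_comparison_eucl[OF bounded_linear.summable[OF bounded_linear_matrix_mult_left assms(1)]];
      rule mps_term_bound[OF assms(3,2)])

text \<open>Weierstrass M-test: the majorant \<open>norm (C i ** ?J)\<close> is independent of
  \<open>W\<close>, so the continuous partial sums converge uniformly.\<close>

lemma continuous_on_mps_eval:
  fixes C :: "nat \<Rightarrow> real ^ 'm ^ 'm"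
  assumes "summable C" "\<And>i. 0 \<le> C i"
  shows "continuous_on {W. substochastic W} (mps_eval C)"
proof (rule uniform_limit_theorem)
  let ?J = "(\<chi> i j. 1) :: real ^ 'm ^ 'm"
  show "uniform_limit {W. substochastic W} (\<lambda>n W. \<Sum>i<n. C i ** mat_pow W i) (mps_eval C) sequentially"
    unfolding mps_eval_def
  proof (rule Weierstrass_m_test)
    have "0 \<le> C i ** ?J" for i
      using assms by (intro matrix_mult_nonneg) (auto simp: less_eq_vec_def)
    then show "summable (\<lambda>i. norm (C i ** ?J))"
      by (intro summable_norm_nonneg_eucl
          bounded_linear.summable[OF bounded_linear_matrix_mult_left] assms)
    show "norm (C i ** mat_pow W i) \<le> norm (C i ** ?J)" if "W \<in> {W. substochastic W}" for i W
      using that assms by (intro norm_le_eucl mps_term_bound) auto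
  qed
  show "\<forall>\<^sub>F n in sequentially. continuous_on {W. substochastic W} (\<lambda>W. \<Sum>i<n. C i ** mat_pow W i)"
    by (intro always_eventually allI continuous_on_sum continuous_on_matrix_mult continuous_on_mat_pow
        continuous_on_const)
qed simp

lemma mps_eval_nonneg:
  assumes "mps_converges C W" "\<And>i. 0 \<le> C i" "0 \<le> W"
  shows "0 \<le> mps_eval C W"
  using assms(1) unfolding mps_eval_def mps_converges_def
  by (rule suminf_nonneg_eucl) (intro matrix_mult_nonneg mat_pow_nonneg assms)

lemma mps_eval_mono:
  assumes "mps_converges C W" "mps_converges C W'" "\<And>i. 0 \<le> C i" "0 \<le> W" "W \<le> W'"
  shows "mps_eval C W \<le> mps_eval C W'"
  using assms(1,2) unfolding mps_eval_def mps_converges_def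
  by (rule suminf_le_eucl) (intro matrix_mult_mono mat_pow_nonneg mat_pow_mono assms order_refl)

text \<open>Powers of \<open>W\<close> do not increase \<open>vec 1\<close>, so replacing each of
  them by the identity can only enlarge the row sums.\<close>

lemma mps_eval_row_sums:
  assumes "summable C" "\<And>i. 0 \<le> C i" "substochastic W"
  shows "mps_eval C W *v vec 1 \<le> suminf C *v vec 1"
proof -
  note row = bounded_linear_matrix_vector_mult_left[of "vec 1"]
  have conv: "summable (\<lambda>i. C i ** mat_pow W i)"
    using mps_converges_substochastic[OF assms] by (simp add: mps_converges_def)
  have "(\<Sum>i. (C i ** mat_pow W i) *v vec 1) \<le> (\<Sum>i. C i *v vec 1)"
  proof (rule suminf_le_eucl)
    show "(C i ** mat_pow W i) *v vec 1 \<le> C i *v vec 1" for i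
      using substochastic_mat_pow[OF assms(3), of i] assms(2)
        matrix_vector_mult_mono[of 0 "mat_pow W i" "vec 1" "vec 1"]
      unfolding matrix_vector_mul_assoc[symmetric]
      by (intro matrix_vector_mult_mono) (auto simp: substochastic_def less_eq_vec_def)
  qed (intro bounded_linear.summable[OF row] conv assms)+
  then show ?thesis
    unfolding mps_eval_def bounded_linear.suminf[OF row conv] bounded_linear.suminf[OF row assms(1)] .
qed

lemma mps_eval_mult_sums:
  assumes "mps_converges C W"
  shows "(\<lambda>i. C i ** mat_pow W i ** M) sums (mps_eval C W ** M)"
  using assms unfolding mps_eval_def mps_converges_def
  by (intro bounded_linear.sums[OF bounded_linear_matrix_mult_left] summable_sums)

section \<open>Polynomial matrix equations\<close>

lemma substochastic_mat_poly:
  fixes C :: "'l \<Rightarrow> real ^ 'm ^ 'm"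
  assumes "\<And>l. l \<in> L \<Longrightarrow> 0 \<le> C l" "(\<Sum>l\<in>L. C l) *v vec 1 \<le> vec 1" "substochastic X"
  shows "substochastic (\<Sum>l\<in>L. C l ** mat_pow X (d l))"
proof -
  have pow: "0 \<le> mat_pow X n" "mat_pow X n *v vec 1 \<le> vec 1" for n
    using substochastic_mat_pow[OF assms(3), of n] by (auto simp: substochastic_def)
  have "(\<Sum>l\<in>L. C l ** mat_pow X (d l)) *v vec 1 = (\<Sum>l\<in>L. C l *v (mat_pow X (d l) *v vec 1))"
    by (simp add: matrix_vector_mult_sum_left matrix_vector_mul_assoc)
  also have "\<dots> \<le> (\<Sum>l\<in>L. C l *v vec 1)"
    using assms(1) pow matrix_vector_mult_mono[of 0 "mat_pow X _" "vec 1" "vec 1"]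
    by (intro sum_mono matrix_vector_mult_mono) (auto simp: less_eq_vec_def)
  also have "\<dots> \<le> vec 1"
    using assms(2) by (simp add: matrix_vector_mult_sum_left)
  finally show ?thesis
    using assms(1) pow by (auto simp: substochastic_def intro!: sum_nonneg matrix_mult_nonneg)
qed

lemma mat_poly_mono:
  fixes C :: "'l \<Rightarrow> real ^ 'm ^ 'm"
  assumes "\<And>l. l \<in> L \<Longrightarrow> 0 \<le> C l" "\<And>l. l \<in> L \<Longrightarrow> C l \<le> C' l" "0 \<le> X" "X \<le> Y"
  shows "(\<Sum>l\<in>L. C l ** mat_pow X (d l)) \<le> (\<Sum>l\<in>L. C' l ** mat_pow Y (d l))"
  using assms by (intro sum_mono matrix_mult_mono mat_pow_mono mat_pow_nonneg)

text \<open>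
  The iterates of the polynomial from \<open>0\<close> stay below every supersolution, not only below every
  solution.
\<close>

lemma mat_poly_minimal_solution:
  fixes C :: "'l \<Rightarrow> real ^ 'm ^ 'm"
  assumes C: "\<And>l. l \<in> L \<Longrightarrow> 0 \<le> C l" "(\<Sum>l\<in>L. C l) *v vec 1 \<le> vec 1"
  shows "\<exists>G. substochastic G \<and> G = (\<Sum>l\<in>L. C l ** mat_pow G (d l)) \<and>
    (\<forall>Y. 0 \<le> Y \<and> (\<Sum>l\<in>L. C l ** mat_pow Y (d l)) \<le> Y \<longrightarrow> G \<le> Y)"
proof -
  define F where "F X = (\<Sum>l\<in>L. C l ** mat_pow X (d l))" for X
  define Z where "Z n = (F ^^ n) 0" for n
  have Z_Suc: "Z (Suc n) = F (Z n)" for n by (simp add: Z_def)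
  have mono: "F X \<le> F Y" if "0 \<le> X" "X \<le> Y" for X Y
    using mat_poly_mono[OF C(1) order_refl that] by (simp add: F_def)
  have sub: "substochastic (Z n)" for n
  proof (induction n)
    case 0 then show ?case by (simp add: Z_def substochastic_0)
  next
    case (Suc n) then show ?case using substochastic_mat_poly[OF C] by (simp add: Z_Suc F_def)
  qed
  then have nonneg: "0 \<le> Z n" for n by (simp add: substochastic_def)
  have "Z n \<le> Z (Suc n)" for n
  proof (induction n)
    case 0 then show ?case using nonneg[of 1] by (simp add: Z_def)
  next
    case (Suc n) then show ?case using mono[OF nonneg Suc] by (simp add: Z_Suc)
  qed
  then have "incseq Z" by (rule incseq_SucI)
  then obtain G where G: "Z \<longlonglongrightarrow> G"
    by (rule incseq_convergent_eucl[OF _ substochastic_le_1[OF sub]])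
  \<comment> \<open>The images \<open>F (Z n)\<close> are the shifted iterates, so they converge
    both to \<open>F G\<close>, by continuity, and to \<open>G\<close>.\<close>
  have "(\<lambda>n. F (Z n)) \<longlonglongrightarrow> F G"
    unfolding F_def by (intro tendsto_sum tendsto_matrix_mult tendsto_const tendsto_mat_pow G)
  moreover have "(\<lambda>n. F (Z n)) \<longlonglongrightarrow> G"
    using LIMSEQ_Suc[OF G] by (simp add: Z_Suc)
  ultimately have "G = F G" by (rule LIMSEQ_unique[rotated])
  moreover have "G \<le> Y" if Y: "0 \<le> Y" "F Y \<le> Y" for Y
  proof (rule LIMSEQ_le_eucl[OF G tendsto_const])
    show "Z n \<le> Y" for n
    proof (induction n)
      case 0 then show ?case using Y by (simp add: Z_def)
    next
      case (Suc n) then show ?case using mono[OF nonneg Suc] Y by (simp add: Z_Suc)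
    qed
  qed
  ultimately show ?thesis
    using substochastic_LIMSEQ[OF G sub] unfolding F_def by blast
qed

lemma minimal_nonneg_solution_unique:
  assumes "minimal_nonneg_solution E G" "minimal_nonneg_solution E H"
  shows "G = H"
  using assms by (auto simp: minimal_nonneg_solution_def intro: order.antisym)

section \<open>Splitting a power series\<close>

text \<open>Coefficients of \<open>z^j\<close> are compared: multiplication by
  \<open>fps_X ^ d\<close> shifts a sequence by \<open>d\<close>. The guard
  \<open>j < nat (l + 1)\<close> supplies the leading zeros, where natural subtraction would
  truncate to \<open>0\<close>.\<close>

lemma from_minus1_decomposition:
  fixes A :: "int \<Rightarrow> real ^ 'm ^ 'm"
  assumes "\<And>r c. (\<Sum>l\<in>{-1..q}. mps_entry (B l) r c * fps_X ^ nat (l + 1)) = mps_entry (from_minus1 A) r c"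
  shows "from_minus1 A j = (\<Sum>l\<in>{-1..q}. if j < nat (l + 1) then 0 else B l (j - nat (l + 1)))"
proof -
  have "from_minus1 A j $ r $ c = (\<Sum>l\<in>{-1..q}. if j < nat (l + 1) then 0 else B l (j - nat (l + 1))) $ r $ c" for r c
  proof -
    have "from_minus1 A j $ r $ c = fps_nth (mps_entry (from_minus1 A) r c) j"
      by (simp add: mps_entry_def)
    also have "\<dots> = (\<Sum>l\<in>{-1..q}. fps_nth (mps_entry (B l) r c * fps_X ^ nat (l + 1)) j)"
      by (simp add: assms[symmetric] fps_sum_nth)
    also have "\<dots> = (\<Sum>l\<in>{-1..q}. (if j < nat (l + 1) then 0 else B l (j - nat (l + 1))) $ r $ c)"
      by (intro sum.cong) (auto simp: fps_X_power_mult_right_nth mps_entry_def)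
    finally show ?thesis by simp
  qed
  then show ?thesis by (simp add: vec_eq_iff)
qed

text \<open>
  Used with \<open>P j = X\<^sup>j\<close> for a solution \<open>X\<close>, and with \<open>P j = I\<close> for the plain sums of coefficients.
\<close>

lemma shifted_series_decomposition:
  fixes a :: "nat \<Rightarrow> real ^ 'm ^ 'm" and C :: "'l \<Rightarrow> nat \<Rightarrow> real ^ 'm ^ 'm"
  assumes L: "finite L" and C: "\<And>l i. l \<in> L \<Longrightarrow> 0 \<le> C l i"
    and a: "\<And>j. a j = (\<Sum>l\<in>L. if j < d l then 0 else C l (j - d l))"
    and P: "\<And>j. 0 \<le> P j" and conv: "summable (\<lambda>j. a j ** P j)"
  shows "l \<in> L \<Longrightarrow> summable (\<lambda>i. C l i ** P (i + d l))"
    and "(\<Sum>l\<in>L. \<Sum>i. C l i ** P (i + d l)) = (\<Sum>j. a j ** P j)"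
proof -
  \<comment> \<open>\<open>e l\<close> is \<open>C l\<close> shifted by \<open>d l\<close> and
    padded with zeros, so that all summands share the index \<open>j\<close> of
    \<open>a\<close>.\<close>
  define e where "e l j = (if j < d l then 0 else C l (j - d l))" for l j
  have e: "0 \<le> e l j" if "l \<in> L" for l j
    using C that by (simp add: e_def)
  have a_e: "a j ** P j = (\<Sum>l\<in>L. e l j ** P j)" for j
    by (simp add: a e_def matrix_mult_sum_left)
  \<comment> \<open>By nonnegativity every summand is at most the whole term
    \<open>a j ** P j\<close>, so convergence of the total series passes to each part.\<close>
  have sum_e: "summable (\<lambda>j. e l j ** P j)" if "l \<in> L" for l
  proof (rule summable_comparison_eucl[OF conv])
    show nonneg: "0 \<le> e l j ** P j" for j
      by (intro matrix_mult_nonneg e that P)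
    show "e l j ** P j \<le> a j ** P j" for j
      unfolding a_e by (rule member_le_sum) (use that L e P in \<open>auto intro: matrix_mult_nonneg\<close>)
  qed
  \<comment> \<open>Dropping the \<open>d l\<close> leading zeros changes neither convergence nor
    the sum.\<close>
  have shift: "(\<lambda>i. e l (i + d l) ** P (i + d l)) sums (\<Sum>j. e l j ** P j)" if "l \<in> L" for l
    by (subst sums_zero_iff_shift) (use sum_e[OF that] in \<open>auto simp: e_def\<close>)
  then have shift: "(\<lambda>i. C l i ** P (i + d l)) sums (\<Sum>j. e l j ** P j)" if "l \<in> L" for l
    using that by (simp add: e_def)
  then show "l \<in> L \<Longrightarrow> summable (\<lambda>i. C l i ** P (i + d l))"
    by (auto simp: summable_def)
  have "(\<Sum>j. a j ** P j) = (\<Sum>l\<in>L. \<Sum>j. e l j ** P j)"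
    unfolding a_e by (rule suminf_sum) (rule sum_e)
  also have "\<dots> = (\<Sum>l\<in>L. \<Sum>i. C l i ** P (i + d l))"
    using shift by (intro sum.cong) (auto simp: sums_iff)
  finally show "(\<Sum>l\<in>L. \<Sum>i. C l i ** P (i + d l)) = (\<Sum>j. a j ** P j)" ..
qed

theorem theorem6:
  fixes A :: "int \<Rightarrow> real ^ 'm ^ 'm"
    and q :: int
    and B :: "int \<Rightarrow> nat \<Rightarrow> real ^ 'm ^ 'm"
  assumes A_nonneg: "\<And>i. i \<ge> -1 \<Longrightarrow> 0 \<le> A i"
    and A_summable: "summable (from_minus1 A)"
    and A_stochastic: "stochastic (\<Sum>j. from_minus1 A j)"
    and q: "q \<ge> -1"
    and B_nonneg: "\<And>l i. l \<in> {-1..q} \<Longrightarrow> 0 \<le> B l i"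
    and B_decomp: "\<And>r c. (\<Sum>l\<in>{-1..q}. mps_entry (B l) r c * fps_X ^ nat (l + 1))
                          = mps_entry (from_minus1 A) r c"
  shows "(\<exists>!X. iteration q B X) \<and>
         (\<forall>X. iteration q B X \<longrightarrow>
            (\<forall>k. 0 \<le> X k \<and> X k \<le> X (Suc k) \<and> X (Suc k) *v vec 1 \<le> vec 1) \<and>
            (\<exists>G. minimal_nonneg_solution (series_equation A) G \<and> incseq X \<and> X \<longlonglongrightarrow> G))"
proof -
  let ?L = "{-1..q}" and ?d = "\<lambda>l. nat (l + 1)"
  let ?F = "\<lambda>W X. \<Sum>l\<in>?L. mps_eval (B l) W ** mat_pow X (?d l)"
  note split = shifted_series_decomposition[of ?L B "from_minus1 A" ?d,
      OF _ B_nonneg from_minus1_decomposition[OF B_decomp], simplified]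

  \<comment> \<open>Coefficients of the step equation at substochastic arguments\<close>
  have B_summable: "summable (B l)" if "l \<in> ?L" for l
    using split(1)[of "\<lambda>_. mat 1" l] that A_summable by (simp add: mat_1_nonneg)
  have B_sum: "(\<Sum>l\<in>?L. suminf (B l)) *v vec 1 = vec 1"
    using split(2)[of "\<lambda>_. mat 1"] A_summable A_stochastic
    by (simp add: stochastic_def mat_1_nonneg)
  have conv: "mps_converges (B l) W" if "substochastic W" "l \<in> ?L" for l W
    using that by (intro mps_converges_substochastic B_summable B_nonneg)
  have eval_nonneg: "0 \<le> mps_eval (B l) W" if "substochastic W" "l \<in> ?L" for l W
    using that conv[OF that] B_nonneg by (intro mps_eval_nonneg) (auto simp: substochastic_def)
  have row: "(\<Sum>l\<in>?L. mps_eval (B l) W) *v vec 1 \<le> vec 1" if "substochastic W" for W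
  proof -
    have "(\<Sum>l\<in>?L. mps_eval (B l) W *v vec 1) \<le> (\<Sum>l\<in>?L. suminf (B l) *v vec 1)"
      by (intro sum_mono mps_eval_row_sums B_summable B_nonneg that)
    then show ?thesis
      unfolding matrix_vector_mult_sum_left[symmetric] B_sum .
  qed
  \<comment> \<open>The comparison with all supersolutions \<open>Y\<close> is kept because
    monotonicity in \<open>k\<close> and minimality of the limit both use a \<open>Y\<close> that
    need not solve the current step equation exactly.\<close>
  have step: "\<exists>G. minimal_nonneg_solution (step_equation q B W) G \<and> substochastic G \<and>
      (\<forall>Y. 0 \<le> Y \<and> ?F W Y \<le> Y \<longrightarrow> G \<le> Y)" if W: "substochastic W" for W
  proof -
    have "\<exists>G. substochastic G \<and> G = ?F W G \<and> (\<forall>Y. 0 \<le> Y \<and> ?F W Y \<le> Y \<longrightarrow> G \<le> Y)"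
      by (intro mat_poly_minimal_solution eval_nonneg[OF W] row[OF W])
    then obtain G where G: "substochastic G" "G = ?F W G"
      "\<forall>Y. 0 \<le> Y \<and> ?F W Y \<le> Y \<longrightarrow> G \<le> Y"
      by (elim exE conjE)
    have "minimal_nonneg_solution (step_equation q B W) G"
      unfolding minimal_nonneg_solution_def step_equation_def
    proof (intro conjI ballI allI impI)
      show "0 \<le> G" using G(1) by (simp add: substochastic_def)
      show "G \<le> Y"
        if "((\<forall>l\<in>?L. mps_converges (B l) W) \<and> Y = ?F W Y) \<and> 0 \<le> Y" for Y
      proof -
        have "?F W Y \<le> Y"
          using that by (elim conjE) (erule order_eq_refl[OF sym])
        with that G(3) show ?thesis by blast
      qed
    qed (erule conv[OF W], rule G(2))
    with G(1,3) show ?thesis by blast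
  qed
  \<comment> \<open>\<open>THE\<close> names a definite matrix where a minimal solution exists;
    \<open>step\<close> guarantees this for substochastic \<open>W\<close>, and the iterates below
    stay substochastic.\<close>
  define N where "N W = (THE G. minimal_nonneg_solution (step_equation q B W) G)" for W
  have N_eq: "N W = G" if "minimal_nonneg_solution (step_equation q B W) G" for W G
    unfolding N_def using that minimal_nonneg_solution_unique by blast
  have N: "minimal_nonneg_solution (step_equation q B W) (N W)" "substochastic (N W)"
    "0 \<le> Y \<Longrightarrow> ?F W Y \<le> Y \<Longrightarrow> N W \<le> Y" if "substochastic W" for W Y
    using step[OF that] N_eq by auto

  \<comment> \<open>Existence and uniqueness of the iteration\<close>
  define X where "X k = (N ^^ k) 0" for k
  have X_Suc: "X (Suc k) = N (X k)" for k by (simp add: X_def)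
  have sub: "substochastic (X k)" for k
    by (induction k) (auto simp: X_def substochastic_0 N(2))
  then have nonneg: "0 \<le> X k" for k by (simp add: substochastic_def)
  have iter: "iteration q B X"
    unfolding iteration_def using N(1)[OF sub] by (simp add: X_Suc) (simp add: X_def)
  have only: "X' = X" if "iteration q B X'" for X'
  proof
    show "X' k = X k" for k
    proof (induction k)
      case 0 then show ?case using that by (simp add: iteration_def X_def)
    next
      case (Suc k)
      have "minimal_nonneg_solution (step_equation q B (X k)) (X' (Suc k))"
        using that unfolding Suc[symmetric] iteration_def by blast
      from N_eq[OF this] show ?case by (simp add: X_Suc)
    qed
  qed
  have X_eq: "X (Suc k) = ?F (X k) (X (Suc k))" for k
    using N(1)[OF sub[of k]] unfolding X_Suc minimal_nonneg_solution_def step_equation_def by (elim conjE)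

  \<comment> \<open>Monotonicity and convergence\<close>
  have inc: "X k \<le> X (Suc k)" for k
  proof (induction k)
    case 0 then show ?case using nonneg[of 1] by (simp add: X_def)
  next
    case (Suc k)
    \<comment> \<open>By the induction hypothesis the coefficients at \<open>X k\<close> are at most
      those at \<open>X (Suc k)\<close>, so \<open>X (Suc (Suc k))\<close> is a supersolution of the
      equation that defines \<open>X (Suc k)\<close>.\<close>
    have "?F (X k) (X (Suc (Suc k))) \<le> ?F (X (Suc k)) (X (Suc (Suc k)))"
      by (intro mat_poly_mono eval_nonneg sub mps_eval_mono conv nonneg Suc order_refl B_nonneg)
    then have "?F (X k) (X (Suc (Suc k))) \<le> X (Suc (Suc k))"
      by (simp only: X_eq[symmetric])
    then show ?case
      unfolding X_Suc[of k] by (intro N(3) sub nonneg)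
  qed
  then have incseq: "incseq X" by (rule incseq_SucI)
  then obtain G where G: "X \<longlonglongrightarrow> G"
    by (rule incseq_convergent_eucl[OF _ substochastic_le_1[OF sub]])
  have G_sub: "substochastic G" by (rule substochastic_LIMSEQ[OF G sub])
  have G_eq: "G = ?F G G"
  proof (rule LIMSEQ_unique)
    \<comment> \<open>The coefficient functions are continuous on substochastic matrices, and both
      the iterates and \<open>G\<close> lie there.\<close>
    have "(\<lambda>k. mps_eval (B l) (X k)) \<longlonglongrightarrow> mps_eval (B l) G" if "l \<in> ?L" for l
      by (rule continuous_on_tendsto_compose[OF continuous_on_mps_eval G])
        (use that B_summable B_nonneg G_sub sub in auto)
    then have "(\<lambda>k. ?F (X k) (X (Suc k))) \<longlonglongrightarrow> ?F G G"
      by (intro tendsto_sum tendsto_matrix_mult tendsto_mat_pow LIMSEQ_Suc[OF G])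
    then show "(\<lambda>k. X (Suc k)) \<longlonglongrightarrow> ?F G G"
      by (simp only: X_eq[symmetric])
  qed (rule LIMSEQ_Suc[OF G])

  \<comment> \<open>The limit as minimal solution of the series equation\<close>
  have A_nonneg': "0 \<le> from_minus1 A j" for j
    by (simp add: from_minus1_def A_nonneg)
  have A_conv: "mps_converges (from_minus1 A) G"
    by (intro mps_converges_substochastic A_summable A_nonneg' G_sub)
  have series_G: "series_equation A G"
  proof -
    \<comment> \<open>The powers \<open>G^i\<close> and \<open>G^(l+1)\<close> merge into one, so
      the fixed-point equation becomes the regrouped series of \<open>from_minus1 A\<close>.\<close>
    have "?F G G = (\<Sum>l\<in>?L. \<Sum>i. B l i ** mat_pow G (i + ?d l))"
      unfolding mat_pow_add matrix_mul_assoc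
      by (intro sum.cong refl sums_unique mps_eval_mult_sums conv G_sub)
    also have "\<dots> = mps_eval (from_minus1 A) G"
      unfolding mps_eval_def using A_conv G_sub
      by (intro split(2)) (auto simp: mps_converges_def substochastic_def intro: mat_pow_nonneg)
    finally show ?thesis
      unfolding series_equation_def G_eq[symmetric] using A_conv by blast
  qed
  have min_G: "G \<le> Y" if Y: "series_equation A Y" "0 \<le> Y" for Y
  proof (rule LIMSEQ_le_eucl[OF G tendsto_const])
    have Y_conv: "summable (\<lambda>j. from_minus1 A j ** mat_pow Y j)"
      using Y(1) unfolding series_equation_def mps_converges_def by (rule conjunct1)
    have Y_eq: "Y = mps_eval (from_minus1 A) Y"
      using Y(1) unfolding series_equation_def by (rule conjunct2)
    show "X k \<le> Y" for k
    proof (induction k)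
      case 0 then show ?case using Y by (simp add: X_def)
    next
      case (Suc k)
      \<comment> \<open>\<open>B\<^sub>l(Y)\<close> need not converge a priori, so \<open>B\<^sub>l(X\<^sub>k) Y\<^bsup>l+1\<^esup>\<close> is compared termwise with the
        series of \<open>B\<^sub>l\<^sub>,\<^sub>i Y\<^bsup>i+l+1\<^esup>\<close>.\<close>
      have "?F (X k) Y \<le> (\<Sum>l\<in>?L. \<Sum>i. B l i ** mat_pow Y (i + ?d l))"
      proof (rule sum_mono)
        fix l assume l: "l \<in> ?L"
        note s = mps_eval_mult_sums[OF conv[OF sub[of k] l], of "mat_pow Y (?d l)"]
        have "(\<Sum>i. B l i ** mat_pow (X k) i ** mat_pow Y (?d l)) \<le> (\<Sum>i. B l i ** mat_pow Y (i + ?d l))"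
        proof (rule suminf_le_eucl)
          show "summable (\<lambda>i. B l i ** mat_pow (X k) i ** mat_pow Y (?d l))"
            using s by (auto simp: summable_def)
          \<comment> \<open>Convergence comes from the full series at \<open>Y\<close>, whose
            nonnegative terms dominate these; \<open>Y\<close> itself may have row sums above
            \<open>1\<close>.\<close>
          show "summable (\<lambda>i. B l i ** mat_pow Y (i + ?d l))"
            using l Y_conv Y(2) by (intro split(1)) (auto intro: mat_pow_nonneg)
          show "B l i ** mat_pow (X k) i ** mat_pow Y (?d l) \<le> B l i ** mat_pow Y (i + ?d l)" for i
            unfolding mat_pow_add matrix_mul_assoc
            by (intro matrix_mult_mono matrix_mult_nonneg mat_pow_nonneg mat_pow_mono order_refl
                B_nonneg l nonneg Suc Y(2))
        qed
        then show "mps_eval (B l) (X k) ** mat_pow Y (?d l) \<le> (\<Sum>i. B l i ** mat_pow Y (i + ?d l))"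
          using s by (simp add: sums_iff)
      qed
      \<comment> \<open>Regrouping recovers the series equation for \<open>Y\<close>, which makes
        \<open>Y\<close> a supersolution of the step equation at \<open>X k\<close>.\<close>
      also have "\<dots> = Y"
        using split(2)[of "mat_pow Y"] Y_conv Y(2) mat_pow_nonneg[OF Y(2)]
        by (simp add: Y_eq[symmetric] mps_eval_def[symmetric])
      finally show ?case
        unfolding X_Suc by (intro N(3) sub Y(2))
    qed
  qed
  have "minimal_nonneg_solution (series_equation A) G"
    using series_G min_G G_sub by (auto simp: minimal_nonneg_solution_def substochastic_def)
  then have "(\<forall>k. 0 \<le> X k \<and> X k \<le> X (Suc k) \<and> X (Suc k) *v vec 1 \<le> vec 1) \<and>
      (\<exists>G. minimal_nonneg_solution (series_equation A) G \<and> incseq X \<and> X \<longlonglongrightarrow> G)"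
    using nonneg inc incseq G sub unfolding substochastic_def by blast
  moreover have "\<exists>!X. iteration q B X"
    by (rule ex1I, rule iter, rule only)
  ultimately show ?thesis
    using only by metis
qed

end
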